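(* For every $\tau\in\mathbb{H}^2$, $$\theta'[\tfrac12,\tfrac12]=\frac14\,\frac{\theta'[1,1]\,\theta^3[0,0]}{\theta^3[\tfrac12,\tfrac12]}\qquad\text{and}\qquad \theta'[\tfrac12,\tfrac32]=-\frac14\,\frac{\theta'[1,1]\,\theta^3[0,0]}{\theta^3[\tfrac12,\tfrac32]}.$$
   Context: $\mathbb{H}^2=\{\tau\in\mathbb{C} : \Im\tau>0\}$ is the upper half plane. For $\epsilon,\epsilon'\in\mathbb{R}$, $\zeta\in\mathbb{C}$, $\tau\in\mathbb{H}^2$, the theta function with characteristics is $$\theta[\epsilon,\epsilon'](\zeta,\tau)=\sum_{n\in\mathbb{Z}}\exp\left(2\pi i\left[\tfrac12\left(n+\tfrac{\epsilon}{2}\right)^2\tau+\left(n+\tfrac{\epsilon}{2}\right)\left(\zeta+\tfrac{\epsilon'}{2}\right)\right]\right).$$ Write $\theta[\epsilon,\epsilon']=\theta[\epsilon,\epsilon'](0,\tau)$ and $\theta'[\epsilon,\epsilon']=\frac{\partial}{\partial\zeta}\theta[\epsilon,\epsilon'](\zeta,\tau)\big|_{\zeta=0}$; $\theta^k[\epsilon,\epsilon']$ means the $k$-th power of $\theta[\epsilon,\epsilon']$. *)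

theory Defs
  imports "HOL-Analysis.Analysis"
begin

(* For Im \<tau> > 0 the series converges absolutely, so the unordered sum over the
   integers is the usual bilateral sum; outside the upper half plane the value is
   not meaningful. *)
definition theta_char :: "real \<Rightarrow> real \<Rightarrow> complex \<Rightarrow> complex \<Rightarrow> complex" where
  "theta_char \<epsilon> \<epsilon>' \<zeta> \<tau> =
     (\<Sum>\<^sub>\<infinity>n::int. exp (2 * of_real pi * \<i> *
        (1 / 2 * (of_int n + of_real \<epsilon> / 2)\<^sup>2 * \<tau>
          + (of_int n + of_real \<epsilon> / 2) * (\<zeta> + of_real \<epsilon>' / 2))))"

definition theta_const :: "real \<Rightarrow> real \<Rightarrow> complex \<Rightarrow> complex" where
  "theta_const \<epsilon> \<epsilon>' \<tau> = theta_char \<epsilon> \<epsilon>' 0 \<tau>"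

definition theta_deriv_const :: "real \<Rightarrow> real \<Rightarrow> complex \<Rightarrow> complex" where
  "theta_deriv_const \<epsilon> \<epsilon>' \<tau> = deriv (\<lambda>\<zeta>. theta_char \<epsilon> \<epsilon>' \<zeta> \<tau>) 0"

end

theory Submission
  imports Defs "HOL-Complex_Analysis.Complex_Analysis"
begin

text \<open>
  Both claims are instances of one identity. Let \<open>\<epsilon>' = r + 1/2\<close> with an integer \<open>r\<close>, and write
  \<open>\<iota> = exp (- \<pi> \<i> \<epsilon>')\<close>, so that \<open>\<iota>\<^sup>2 = - 1\<close>. Abbreviate the values at the doubled modulus by
  \<open>A = \<theta>[0,0](2\<tau>)\<close>, \<open>B = \<theta>[1,0](2\<tau>)\<close>, \<open>T = \<theta>[1/2,2\<epsilon>'](2\<tau>)\<close>, \<open>D = \<theta>'[1/2,2\<epsilon>'](2\<tau>)\<close>. Then, at \<open>\<tau>\<close>,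

  \<^item> \<open>\<theta>'[1/2,\<epsilon>'] \<theta>[1/2,\<epsilon>'] = D (A - \<iota> B)\<close>,
  \<^item> \<open>\<theta>[1/2,\<epsilon>']\<^sup>2 = T (A + \<iota> B)\<close>,
  \<^item> \<open>\<theta>[0,0]\<^sup>2 = A\<^sup>2 + B\<^sup>2\<close>,
  \<^item> \<open>(-1)^r \<theta>'[1,1] \<theta>[0,0] = 4 D T\<close>.

  Multiplying the first two and using \<open>(A - \<iota> B) (A + \<iota> B) = A\<^sup>2 + B\<^sup>2\<close> gives
  \<open>4 \<theta>'[1/2,\<epsilon>'] \<theta>[1/2,\<epsilon>']\<^sup>3 = (-1)^r \<theta>'[1,1] \<theta>[0,0]\<^sup>3\<close>. Each of the four identities is a rearrangement
  of a double series over pairs \<open>(m, n)\<close>: the substitution by half-sum and half-difference turns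
  \<open>x\<^sup>2 + y\<^sup>2\<close> into \<open>2 s\<^sup>2 + 2 d\<^sup>2\<close> and so doubles the modulus; it splits the pairs according to the parity
  of \<open>m + n\<close>, and each parity class is built from products of two simple series again.

  Dividing by \<open>\<theta>[1/2,\<epsilon>']\<^sup>3\<close> needs that this constant is nonzero. The same rearrangement shows
  \<open>\<theta>[\<epsilon>,\<epsilon>'](\<tau>) \<theta>[\<epsilon>,\<epsilon>'+1](\<tau>) = \<theta>[\<epsilon>,2\<epsilon>'+1](2\<tau>) \<theta>[0,1](2\<tau>)\<close>, so non-vanishing at \<open>2\<tau>\<close> for the
  first characteristics \<open>\<epsilon>\<close> and \<open>0\<close> and all second ones implies it at \<open>\<tau>\<close>. After finitely many doublings the imaginary part is so large that the term \<open>n = 0\<close>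
  outweighs all the others together.
\<close>

section \<open>Sums over pairs of integers\<close>

lemma has_sum_product:
  fixes f :: "'a \<Rightarrow> complex" and g :: "'b \<Rightarrow> complex"
  assumes "(\<lambda>x. norm (f x)) summable_on A" "(\<lambda>y. norm (g y)) summable_on B"
    and "(f has_sum a) A" "(g has_sum b) B"
  shows "((\<lambda>(x, y). f x * g y) has_sum a * b) (A \<times> B)"
proof -
  have "\<bar>norm (f x) * (\<Sum>\<^sub>\<infinity>y\<in>B. norm (g y))\<bar> = norm (f x) * (\<Sum>\<^sub>\<infinity>y\<in>B. norm (g y))" for x
    by (simp add: infsum_nonneg)
  then have "(\<lambda>z. norm (case z of (x, y) \<Rightarrow> f x * g y)) summable_on A \<times> B"
    using assms(1,2)
    by (subst Infinite_Sum.abs_summable_on_Sigma_iff)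
       (auto simp: norm_mult infsum_cmult_right' intro!: summable_on_cmult_right summable_on_cmult_left)
  then have "(\<lambda>(x, y). f x * g y) summable_on A \<times> B"
    by (rule abs_summable_summable)
  then show ?thesis
    using has_sum_cmult_left[OF assms(3), of b] has_sum_cmult_right[OF assms(4)]
    by (intro has_sum_SigmaI[where g = "\<lambda>x. f x * b"]) auto
qed

text \<open>
  The map \<open>(p, q) \<mapsto> (p + q, p - q)\<close> reaches exactly the pairs with even sum. The odd pairs are
  parametrised by \<open>(- p - q - 1, q - p)\<close>, with the signs chosen such that for a series over
  \<open>(m + a, n + b)\<close> with \<open>a + b = 1/2\<close> half the sum becomes \<open>- (p + 1/4)\<close>, a mere reflection of the
  value \<open>p + 1/4\<close> from the even pairs.
\<close>

lemma has_sum_parity_split: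
  fixes F :: "int \<Rightarrow> int \<Rightarrow> complex"
  assumes even: "((\<lambda>(p, q). F (p + q) (p - q)) has_sum a) UNIV"
    and odd: "((\<lambda>(p, q). F (- p - q - 1) (q - p)) has_sum b) UNIV"
  shows "((\<lambda>(m, n). F m n) has_sum a + b) UNIV"
proof -
  have "((\<lambda>(m, n). F m n) has_sum a) {(m, n). even (m + n)}"
    using even
    by (rule iffD1[OF has_sum_reindex_bij_witness[where
          i = "\<lambda>(m, n). ((m + n) div 2, (m - n) div 2)" and j = "\<lambda>(p, q). (p + q, p - q)"], rotated -1])
       (auto, presburger+)
  moreover have "((\<lambda>(m, n). F m n) has_sum b) {(m, n). odd (m + n)}"
    using odd
    by (rule iffD1[OF has_sum_reindex_bij_witness[where
          i = "\<lambda>(m, n). ((- m - n - 1) div 2, (n - m - 1) div 2)"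
          and j = "\<lambda>(p, q). (- p - q - 1, q - p)"], rotated -1])
       (auto, presburger+)
  ultimately have "((\<lambda>(m, n). F m n) has_sum a + b) ({(m, n). even (m + n)} \<union> {(m, n). odd (m + n)})"
    by (rule has_sum_Un_disjoint) auto
  moreover have "{(m, n). even (m + n)} \<union> {(m, n). odd (m + n)} = (UNIV :: (int \<times> int) set)"
    by auto
  ultimately show ?thesis
    by simp
qed

section \<open>Theta series\<close>

definition e2pi :: "complex \<Rightarrow> complex" where
  "e2pi z = exp (2 * of_real pi * \<i> * z)"

lemma e2pi_add: "e2pi (z + w) = e2pi z * e2pi w"
  by (simp add: e2pi_def ring_distribs exp_add)

lemma e2pi_of_int [simp]: "e2pi (of_int k) = 1"
  using exp_integer_2pi[of "of_int k"] by (simp add: e2pi_def mult_ac)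

lemma e2pi_half: "e2pi (1 / 2) = - 1"
  by (simp add: e2pi_def mult.commute)

lemma e2pi_eqI: "z = w + of_int k \<Longrightarrow> e2pi z = e2pi w"
  by (simp add: e2pi_add)

lemma e2pi_uminus_eqI: "z = w + of_int k + 1 / 2 \<Longrightarrow> e2pi z = - e2pi w"
  by (simp add: e2pi_add e2pi_half)

lemma norm_e2pi: "norm (e2pi z) = exp (- 2 * pi * Im z)"
  by (simp add: e2pi_def)

text \<open>
  The summation variable of a theta series is a real number here, so that the shift by
  \<open>\<epsilon> / 2\<close>, reflections, and half-sums of summation variables are all changes of one argument.
\<close>

definition theta_term :: "complex \<Rightarrow> complex \<Rightarrow> real \<Rightarrow> complex" where
  "theta_term \<tau> z x = e2pi (of_real x ^ 2 * \<tau> / 2 + of_real x * z)"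

lemma theta_char_eq_infsum:
  "theta_char \<epsilon> \<epsilon>' \<zeta> \<tau> = (\<Sum>\<^sub>\<infinity>n. theta_term \<tau> (\<zeta> + of_real \<epsilon>' / 2) (of_int n + \<epsilon> / 2))"
  by (simp add: theta_char_def theta_term_def e2pi_def)

lemma norm_theta_term:
  "norm (theta_term \<tau> z x) = exp (- pi * Im \<tau> * x ^ 2 - 2 * pi * x * Im z)"
  by (simp add: theta_term_def norm_e2pi algebra_simps flip: of_real_power)

lemma norm_theta_term_le:
  assumes "\<bar>Im z\<bar> \<le> C"
  shows "norm (theta_term \<tau> z x) \<le> exp (- (pi * Im \<tau>) * x ^ 2 + (2 * pi * C) * \<bar>x\<bar>)"
proof -
  have "- (x * Im z) \<le> \<bar>Im z\<bar> * \<bar>x\<bar>"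
    by (metis abs_ge_minus_self abs_mult mult.commute)
  also have "\<dots> \<le> C * \<bar>x\<bar>"
    using assms by (intro mult_right_mono) auto
  finally have "2 * pi * (- (x * Im z)) \<le> 2 * pi * (C * \<bar>x\<bar>)"
    by (intro mult_left_mono) auto
  then show ?thesis
    by (simp add: norm_theta_term mult.assoc)
qed

lemma has_sum_power_nonzero_int:
  fixes r :: real
  assumes "0 \<le> r" "r < 1"
  shows "((\<lambda>n::int. r ^ nat \<bar>n\<bar>) has_sum 2 * (r / (1 - r))) (- {0})"
proof -
  have geom: "((\<lambda>n::nat. r ^ n) has_sum r / (1 - r)) {1..}"
    using assms by (intro has_sum_geometric_from_1) auto
  have "((\<lambda>n::int. r ^ nat \<bar>n\<bar>) has_sum r / (1 - r)) {1..}"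
    using geom
    by (rule iffD1[OF has_sum_reindex_bij_witness[where i = nat and j = int], rotated -1]) auto
  moreover have "((\<lambda>n::int. r ^ nat \<bar>n\<bar>) has_sum r / (1 - r)) {..-1}"
    using geom
    by (rule iffD1[OF has_sum_reindex_bij_witness[where i = "\<lambda>n. nat (- n)" and j = "\<lambda>n. - int n"],
          rotated -1]) auto
  ultimately have "((\<lambda>n::int. r ^ nat \<bar>n\<bar>) has_sum r / (1 - r) + r / (1 - r)) ({1..} \<union> {..-1})"
    by (rule has_sum_Un_disjoint) auto
  moreover have "{1..} \<union> {..-1} = - {0::int}"
    by auto
  ultimately show ?thesis
    by simp
qed

text \<open>
  The linear term \<open>d\<close> absorbs the factor \<open>n + \<epsilon> / 2\<close> of a differentiated theta series as well as the
  growth in \<open>\<zeta>\<close>; completing the square compares the Gaussian with a geometric series.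
\<close>

lemma summable_gaussian_int:
  fixes c d a :: real
  assumes "c > 0"
  shows "(\<lambda>n::int. exp (- c * (of_int n + a) ^ 2 + d * \<bar>of_int n + a\<bar>)) summable_on UNIV"
proof -
  define K where "K = (d + 1) ^ 2 / (4 * c) + \<bar>a\<bar>"
  have "(\<lambda>n::int. exp (-1 :: real) ^ nat \<bar>n\<bar>) summable_on insert 0 (- {0})"
    using has_sum_power_nonzero_int[of "exp (-1)"]
    by (intro iffD2[OF summable_on_insert_iff]) (auto dest: has_sum_imp_summable)
  moreover have "insert 0 (- {0}) = (UNIV :: int set)"
    by auto
  ultimately have "(\<lambda>n::int. exp K * exp (-1) ^ nat \<bar>n\<bar>) summable_on UNIV"
    by (intro summable_on_cmult_right) simp
  moreover have "norm (exp (- c * (of_int n + a) ^ 2 + d * \<bar>of_int n + a\<bar>)) \<le> exp K * exp (-1) ^ nat \<bar>n\<bar>"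
    for n :: int
  proof -
    define x where "x = \<bar>of_int n + a\<bar>"
    \<comment> \<open>The maximum of \<open>- c x\<^sup>2 + (d + 1) x\<close> is \<open>(d + 1)\<^sup>2 / (4 c)\<close>.\<close>
    have "0 \<le> (2 * c * x - (d + 1)) ^ 2 / (4 * c)"
      using assms by simp
    also have "\<dots> = c * x ^ 2 - (d + 1) * x + (d + 1) ^ 2 / (4 * c)"
      using assms by (simp add: field_simps power2_eq_square)
    finally have "- c * x ^ 2 + d * x \<le> (d + 1) ^ 2 / (4 * c) - x"
      by (simp add: algebra_simps)
    also have "\<dots> \<le> K - \<bar>of_int n\<bar>"
      unfolding K_def x_def by linarith
    finally have "exp (- c * x ^ 2 + d * x) \<le> exp (K - \<bar>of_int n\<bar>)"
      by simp
    also have "\<dots> = exp K * exp (-1) ^ nat \<bar>n\<bar>"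
      by (simp add: exp_diff exp_minus field_simps flip: exp_of_nat_mult)
    finally show ?thesis
      by (simp add: x_def)
  qed
  ultimately have "(\<lambda>n::int. norm (exp (- c * (of_int n + a) ^ 2 + d * \<bar>of_int n + a\<bar>))) summable_on UNIV"
    by (rule Infinite_Sum.abs_summable_on_comparison_test')
  then show ?thesis
    by simp
qed

lemma abs_summable_theta_term:
  assumes "Im \<tau> > 0"
  shows "(\<lambda>n::int. norm (theta_term \<tau> z (of_int n + a))) summable_on UNIV"
proof (rule Infinite_Sum.abs_summable_on_comparison_test')
  show "(\<lambda>n::int. exp (- (pi * Im \<tau>) * (of_int n + a) ^ 2 + (2 * pi * \<bar>Im z\<bar>) * \<bar>of_int n + a\<bar>))
          summable_on UNIV"
    using assms by (intro summable_gaussian_int) simp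
  fix n :: int
  show "norm (theta_term \<tau> z (of_int n + a))
      \<le> exp (- (pi * Im \<tau>) * (of_int n + a) ^ 2 + (2 * pi * \<bar>Im z\<bar>) * \<bar>of_int n + a\<bar>)"
    by (rule norm_theta_term_le) simp
qed

lemma abs_summable_theta_term_deriv:
  assumes "Im \<tau> > 0"
  shows "(\<lambda>n::int. norm (of_real (of_int n + a) * theta_term \<tau> z (of_int n + a))) summable_on UNIV"
proof (rule Infinite_Sum.abs_summable_on_comparison_test')
  show "(\<lambda>n::int. exp (- (pi * Im \<tau>) * (of_int n + a) ^ 2 + (1 + 2 * pi * \<bar>Im z\<bar>) * \<bar>of_int n + a\<bar>))
          summable_on UNIV"
    using assms by (intro summable_gaussian_int) simp
  fix n :: int
  define x where "x = of_int n + a"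
  have "norm (of_real x * theta_term \<tau> z x)
      \<le> exp \<bar>x\<bar> * exp (- (pi * Im \<tau>) * x ^ 2 + (2 * pi * \<bar>Im z\<bar>) * \<bar>x\<bar>)"
    unfolding norm_mult
  proof (rule mult_mono)
    show "norm (complex_of_real x) \<le> exp \<bar>x\<bar>"
      using exp_ge_add_one_self[of "\<bar>x\<bar>"] unfolding norm_of_real by linarith
    show "norm (theta_term \<tau> z x) \<le> exp (- (pi * Im \<tau>) * x ^ 2 + (2 * pi * \<bar>Im z\<bar>) * \<bar>x\<bar>)"
      by (rule norm_theta_term_le) simp
  qed auto
  also have "\<dots> = exp (- (pi * Im \<tau>) * x ^ 2 + (1 + 2 * pi * \<bar>Im z\<bar>) * \<bar>x\<bar>)"
    by (simp add: algebra_simps flip: exp_add)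
  finally show "norm (of_real (of_int n + a) * theta_term \<tau> z (of_int n + a))
      \<le> exp (- (pi * Im \<tau>) * (of_int n + a) ^ 2 + (1 + 2 * pi * \<bar>Im z\<bar>) * \<bar>of_int n + a\<bar>)"
    by (simp add: x_def)
qed

lemma has_sum_theta_const:
  assumes "Im \<tau> > 0"
  shows "((\<lambda>n. theta_term \<tau> (of_real (\<epsilon>' / 2)) (of_int n + \<epsilon> / 2)) has_sum theta_const \<epsilon> \<epsilon>' \<tau>) UNIV"
  using has_sum_infsum[OF abs_summable_summable[OF abs_summable_theta_term[OF assms]]]
  by (simp add: theta_const_def theta_char_eq_infsum)

text \<open>
  The series converges uniformly for \<open>\<zeta>\<close> in the unit disc, by the Weierstrass test with a Gaussian
  majorant, and a uniform limit of holomorphic functions may be differentiated term by term.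
\<close>

lemma has_sum_theta_deriv_const:
  assumes "Im \<tau> > 0"
  shows "((\<lambda>n. of_real (of_int n + \<epsilon> / 2) * theta_term \<tau> (of_real (\<epsilon>' / 2)) (of_int n + \<epsilon> / 2))
           has_sum theta_deriv_const \<epsilon> \<epsilon>' \<tau> / (2 * of_real pi * \<i>)) UNIV"
proof -
  define u where "u n \<zeta> = theta_term \<tau> (\<zeta> + of_real \<epsilon>' / 2) (of_int n + \<epsilon> / 2)" for n :: int and \<zeta>
  define u' where "u' n \<zeta> = 2 * of_real pi * \<i> * of_real (of_int n + \<epsilon> / 2) * u n \<zeta>" for n :: int and \<zeta>
  have u': "(u n has_field_derivative u' n \<zeta>) (at \<zeta> within S)" for n \<zeta> S
    unfolding u_def u'_def theta_term_def e2pi_def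
    by (rule derivative_eq_intros refl | simp add: mult_ac)+
  define M where "M n = exp (- (pi * Im \<tau>) * (of_int n + \<epsilon> / 2) ^ 2 + (2 * pi) * \<bar>of_int n + \<epsilon> / 2\<bar>)"
    for n :: int
  have ulim: "uniform_limit (cball 0 1) (\<lambda>X \<zeta>. \<Sum>n\<in>X. u n \<zeta>) (\<lambda>\<zeta>. \<Sum>\<^sub>\<infinity>n. u n \<zeta>) (finite_subsets_at_top UNIV)"
  proof (rule Weierstrass_m_test_general)
    show "M summable_on UNIV"
      unfolding M_def using assms by (intro summable_gaussian_int) simp
    fix n :: int and \<zeta> :: complex
    assume "\<zeta> \<in> cball 0 1"
    then have "\<bar>Im \<zeta>\<bar> \<le> 1"
      using abs_Im_le_cmod[of \<zeta>] by simp
    then show "norm (u n \<zeta>) \<le> M n"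
      using norm_theta_term_le[of "\<zeta> + of_real \<epsilon>' / 2" 1] by (simp add: u_def M_def)
  qed
  have "eventually (\<lambda>X. continuous_on (cball 0 1) (\<lambda>\<zeta>. \<Sum>n\<in>X. u n \<zeta>) \<and>
      (\<forall>\<zeta>\<in>ball 0 1. ((\<lambda>\<zeta>. \<Sum>n\<in>X. u n \<zeta>) has_field_derivative (\<Sum>n\<in>X. u' n \<zeta>)) (at \<zeta>)))
      (finite_subsets_at_top UNIV)"
    using u' by (intro always_eventually allI conjI ballI DERIV_sum continuous_on_sum DERIV_continuous_on)
  then obtain g' where g': "\<And>\<zeta>. \<zeta> \<in> ball 0 1 \<Longrightarrow>
      ((\<lambda>\<zeta>. \<Sum>\<^sub>\<infinity>n. u n \<zeta>) has_field_derivative g' \<zeta>) (at \<zeta>) \<and>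
      ((\<lambda>X. \<Sum>n\<in>X. u' n \<zeta>) \<longlongrightarrow> g' \<zeta>) (finite_subsets_at_top UNIV)"
    by (rule has_complex_derivative_uniform_limit[OF _ ulim]) auto
  have "theta_deriv_const \<epsilon> \<epsilon>' \<tau> = g' 0"
    using g'[of 0] DERIV_imp_deriv
    by (auto simp: theta_deriv_const_def theta_char_eq_infsum u_def)
  moreover have "((\<lambda>n. u' n 0) has_sum g' 0) UNIV"
    using g'[of 0] by (auto simp: has_sum_def)
  ultimately show ?thesis
    using has_sum_divide_const[where f = "\<lambda>n. u' n 0" and S = "g' 0" and c = "2 * of_real pi * \<i>"]
    by (simp add: u'_def u_def)
qed

lemma has_sum_theta_const_mult:
  assumes "Im \<tau> > 0"
  shows "((\<lambda>(m, n). theta_term \<tau> (of_real (b / 2)) (of_int m + a / 2)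
             * theta_term \<tau> (of_real (d / 2)) (of_int n + c / 2))
           has_sum theta_const a b \<tau> * theta_const c d \<tau>) UNIV"
  using has_sum_product[OF abs_summable_theta_term abs_summable_theta_term
      has_sum_theta_const has_sum_theta_const, OF assms assms assms assms]
  unfolding UNIV_Times_UNIV .

lemma has_sum_theta_deriv_const_mult:
  assumes "Im \<tau> > 0"
  shows "((\<lambda>(m, n). (of_real (of_int m + a / 2) * theta_term \<tau> (of_real (b / 2)) (of_int m + a / 2))
             * theta_term \<tau> (of_real (d / 2)) (of_int n + c / 2))
           has_sum theta_deriv_const a b \<tau> / (2 * of_real pi * \<i>) * theta_const c d \<tau>) UNIV"
  using has_sum_product[OF abs_summable_theta_term_deriv abs_summable_theta_term
      has_sum_theta_deriv_const has_sum_theta_const, OF assms assms assms assms]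
  unfolding UNIV_Times_UNIV .

lemma has_sum_theta_const_mult_deriv:
  assumes "Im \<tau> > 0"
  shows "((\<lambda>(m, n). theta_term \<tau> (of_real (d / 2)) (of_int m + c / 2)
             * (of_real (of_int n + a / 2) * theta_term \<tau> (of_real (b / 2)) (of_int n + a / 2)))
           has_sum theta_const c d \<tau> * (theta_deriv_const a b \<tau> / (2 * of_real pi * \<i>))) UNIV"
  using has_sum_product[OF abs_summable_theta_term abs_summable_theta_term_deriv
      has_sum_theta_const has_sum_theta_deriv_const, OF assms assms assms assms]
  unfolding UNIV_Times_UNIV .

text \<open>
  Since \<open>(s + d)\<^sup>2 + (s - d)\<^sup>2 = 2 s\<^sup>2 + 2 d\<^sup>2\<close>, a product of two terms factors into a function of \<open>s\<close> and a
  function of \<open>d\<close>, both of modulus \<open>2 \<tau>\<close>. All bilinear identities below rest on this.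
\<close>

lemma theta_term_mult:
  "theta_term \<tau> z (s + d) * theta_term \<tau> w (s - d) =
     theta_term (2 * \<tau>) (z + w) s * theta_term (2 * \<tau>) (z - w) d"
  unfolding theta_term_def e2pi_add[symmetric]
  by (rule arg_cong[where f = e2pi]) (simp add: field_simps power2_eq_square)

lemma theta_term_minus: "theta_term \<tau> z (- x) = theta_term \<tau> (- z) x"
  by (simp add: theta_term_def)

lemma theta_term_add: "theta_term \<tau> (z + c) x = e2pi (of_real x * c) * theta_term \<tau> z x"
  by (simp add: theta_term_def e2pi_add[symmetric] algebra_simps)

section \<open>Non-vanishing of theta constants\<close>

text \<open>
  The terms with index \<open>n\<close> and \<open>- n - 1\<close> cancel.
\<close>

lemma theta_const_1_1_eq_0:
  assumes "Im \<tau> > 0"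
  shows "theta_const 1 1 \<tau> = 0"
proof -
  define f where "f n = theta_term \<tau> (of_real (1 / 2)) (of_int n + 1 / 2)" for n :: int
  have f: "(f has_sum theta_const 1 1 \<tau>) UNIV"
    unfolding f_def by (rule has_sum_theta_const[OF assms])
  have "f (- n - 1) = - f n" for n
  proof -
    have "f (- n - 1) = theta_term \<tau> (of_real (1 / 2)) (- (of_int n + 1 / 2))"
      unfolding f_def by (rule arg_cong[where f = "theta_term \<tau> (of_real (1 / 2))"]) simp
    also have "\<dots> = theta_term \<tau> (of_real (1 / 2) + (- 1)) (of_int n + 1 / 2)"
      unfolding theta_term_minus by simp
    also have "\<dots> = e2pi (- (of_int n + 1 / 2)) * f n"
      unfolding theta_term_add f_def by simp
    also have "e2pi (- (of_int n + 1 / 2)) = - e2pi (of_int 0)"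
      by (rule e2pi_uminus_eqI[of _ _ "- n - 1"]) simp
    finally show ?thesis
      unfolding e2pi_of_int by simp
  qed
  moreover have "((\<lambda>n. f (- n - 1)) has_sum theta_const 1 1 \<tau>) UNIV"
    using f by (rule iffD1[OF has_sum_reindex_bij_witness[where
      i = "\<lambda>n. - n - 1" and j = "\<lambda>n. - n - 1"], rotated -1]) auto
  ultimately have "((\<lambda>n. - f n) has_sum theta_const 1 1 \<tau>) UNIV"
    by simp
  then have "- theta_const 1 1 \<tau> = theta_const 1 1 \<tau>"
    using has_sum_uminusI[OF f] has_sum_unique by blast
  then show ?thesis
    by simp
qed

text \<open>
  The pairs with even sum give the right-hand side. Those with odd sum give a multiple of
  \<open>\<theta>[1,1](2\<tau>) = 0\<close>.
\<close>

lemma theta_const_duplication: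
  assumes "Im \<tau> > 0"
  shows "theta_const \<epsilon> \<epsilon>' \<tau> * theta_const \<epsilon> (\<epsilon>' + 1) \<tau> =
           theta_const \<epsilon> (2 * \<epsilon>' + 1) (2 * \<tau>) * theta_const 0 1 (2 * \<tau>)"
proof -
  have \<tau>2: "Im (2 * \<tau>) > 0"
    using assms by simp
  define F where "F m n = theta_term \<tau> (of_real (\<epsilon>' / 2)) (of_int m + \<epsilon> / 2)
      * theta_term \<tau> (of_real ((\<epsilon>' + 1) / 2)) (of_int n + \<epsilon> / 2)" for m n :: int
  have F: "((\<lambda>(m, n). F m n) has_sum theta_const \<epsilon> \<epsilon>' \<tau> * theta_const \<epsilon> (\<epsilon>' + 1) \<tau>) UNIV"
    unfolding F_def by (rule has_sum_theta_const_mult[OF assms])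
  have even: "F (p + q) (p - q) =
      theta_term (2 * \<tau>) (of_real ((2 * \<epsilon>' + 1) / 2)) (of_int p + \<epsilon> / 2)
      * theta_term (2 * \<tau>) (of_real (1 / 2)) (of_int q + 0 / 2)" for p q
  proof -
    have "F (p + q) (p - q) =
        theta_term \<tau> (of_real (\<epsilon>' / 2)) ((of_int p + \<epsilon> / 2) + of_int q)
        * theta_term \<tau> (of_real ((\<epsilon>' + 1) / 2)) ((of_int p + \<epsilon> / 2) - of_int q)"
      unfolding F_def by (intro arg_cong2[where f = "(*)"] arg_cong2[where f = "theta_term \<tau>"]) auto
    also have "\<dots> = theta_term (2 * \<tau>) (of_real ((2 * \<epsilon>' + 1) / 2)) (of_int p + \<epsilon> / 2)
        * theta_term (2 * \<tau>) (of_real (1 / 2) + (- 1)) (of_int q)"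
      unfolding theta_term_mult
      by (intro arg_cong2[where f = "(*)"] arg_cong2[where f = "theta_term (2 * \<tau>)"])
         (auto simp: field_simps)
    also have "theta_term (2 * \<tau>) (of_real (1 / 2) + (- 1)) (of_int q) =
        theta_term (2 * \<tau>) (of_real (1 / 2)) (of_int q + 0 / 2)"
      unfolding theta_term_add using e2pi_of_int[of "- q"] by simp
    finally show ?thesis .
  qed
  have odd: "F (- p - q - 1) (q - p) =
      theta_term (2 * \<tau>) (of_real ((- (2 * \<epsilon>' + 1)) / 2)) (of_int p + (1 - \<epsilon>) / 2)
      * theta_term (2 * \<tau>) (of_real (1 / 2)) (of_int q + 1 / 2)" for p q
  proof -
    have "F (- p - q - 1) (q - p) =
        theta_term \<tau> (of_real (\<epsilon>' / 2)) (- (of_int p + (1 - \<epsilon>) / 2) + - (of_int q + 1 / 2))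
        * theta_term \<tau> (of_real ((\<epsilon>' + 1) / 2)) (- (of_int p + (1 - \<epsilon>) / 2) - - (of_int q + 1 / 2))"
      unfolding F_def
      by (intro arg_cong2[where f = "(*)"] arg_cong2[where f = "theta_term \<tau>"]) (auto simp: field_simps)
    also have "\<dots> = theta_term (2 * \<tau>) (of_real ((- (2 * \<epsilon>' + 1)) / 2)) (of_int p + (1 - \<epsilon>) / 2)
        * theta_term (2 * \<tau>) (of_real (1 / 2)) (of_int q + 1 / 2)"
      unfolding theta_term_mult theta_term_minus
      by (intro arg_cong2[where f = "(*)"] arg_cong2[where f = "theta_term (2 * \<tau>)"])
         (auto simp: field_simps)
    finally show ?thesis .
  qed
  have "((\<lambda>(p, q). F (p + q) (p - q)) has_sum
      theta_const \<epsilon> (2 * \<epsilon>' + 1) (2 * \<tau>) * theta_const 0 1 (2 * \<tau>)) UNIV"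
    unfolding even by (rule has_sum_theta_const_mult[OF \<tau>2])
  moreover have "((\<lambda>(p, q). F (- p - q - 1) (q - p)) has_sum
      theta_const (1 - \<epsilon>) (- (2 * \<epsilon>' + 1)) (2 * \<tau>) * theta_const 1 1 (2 * \<tau>)) UNIV"
    unfolding odd by (rule has_sum_theta_const_mult[OF \<tau>2])
  ultimately have "((\<lambda>(m, n). F m n) has_sum
      theta_const \<epsilon> (2 * \<epsilon>' + 1) (2 * \<tau>) * theta_const 0 1 (2 * \<tau>)
      + theta_const (1 - \<epsilon>) (- (2 * \<epsilon>' + 1)) (2 * \<tau>) * theta_const 1 1 (2 * \<tau>)) UNIV"
    by (rule has_sum_parity_split)
  then show ?thesis
    using has_sum_unique[OF F] theta_const_1_1_eq_0[OF \<tau>2] by simp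
qed

text \<open>
  Relative to the term with index \<open>0\<close>, the term with index \<open>n\<close> is at most \<open>r ^ \<bar>n\<bar>\<close> with
  \<open>r = exp (- \<pi> Im \<tau> (1 - \<bar>\<epsilon>\<bar>)) < 1/3\<close>, because \<open>n\<^sup>2 + n \<epsilon> \<ge> \<bar>n\<bar> (1 - \<bar>\<epsilon>\<bar>)\<close>. The sum
  \<open>2 r / (1 - r)\<close> of these bounds over \<open>n \<noteq> 0\<close> is less than \<open>1\<close>.
\<close>

lemma theta_const_neq_0_large_Im:
  assumes "\<bar>\<epsilon>\<bar> < 1" and large: "Im \<tau> * (1 - \<bar>\<epsilon>\<bar>) \<ge> 1"
  shows "theta_const \<epsilon> \<epsilon>' \<tau> \<noteq> 0"
proof
  assume zero: "theta_const \<epsilon> \<epsilon>' \<tau> = 0"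
  have \<tau>: "Im \<tau> > 0"
    using assms by (smt (verit) mult_nonpos_nonneg)
  define f where "f n = theta_term \<tau> (of_real (\<epsilon>' / 2)) (of_int n + \<epsilon> / 2)" for n :: int
  define r where "r = exp (- pi * (Im \<tau> * (1 - \<bar>\<epsilon>\<bar>)))"
  have "pi * 1 \<le> pi * (Im \<tau> * (1 - \<bar>\<epsilon>\<bar>))"
    using large by (intro mult_left_mono) auto
  then have "3 < exp (pi * (Im \<tau> * (1 - \<bar>\<epsilon>\<bar>)))"
    using exp_ge_add_one_self[of "pi * (Im \<tau> * (1 - \<bar>\<epsilon>\<bar>))"] pi_gt3 by linarith
  moreover have "exp (pi * (Im \<tau> * (1 - \<bar>\<epsilon>\<bar>))) = inverse r"
    by (simp add: r_def exp_minus)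
  moreover have "0 < r"
    by (simp add: r_def)
  ultimately have r: "0 < r" "3 * r < 1"
    by (simp_all only: field_simps)
  have "(f has_sum theta_const \<epsilon> \<epsilon>' \<tau>) UNIV"
    unfolding f_def by (rule has_sum_theta_const[OF \<tau>])
  then have "(f has_sum theta_const \<epsilon> \<epsilon>' \<tau> - f 0) (UNIV - {0})"
    by (rule has_sum_Diff) (auto intro: has_sum_finiteI)
  then have tail: "(f has_sum - f 0) (- {0})"
    by (simp add: zero Compl_eq_Diff_UNIV)
  have term_le: "norm (f n) \<le> norm (f 0) * r ^ nat \<bar>n\<bar>" for n
  proof -
    define k where "k = \<bar>of_int n :: real\<bar>"
    have "k * 1 \<le> k * k"
    proof (cases "n = 0")
      case False
      then have "1 \<le> k"
        unfolding k_def by linarith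
      then show ?thesis
        by (intro mult_left_mono) auto
    qed (simp add: k_def)
    moreover have "- (k * \<bar>\<epsilon>\<bar>) \<le> of_int n * \<epsilon>"
      using abs_ge_minus_self[of "of_int n * \<epsilon>"] by (simp add: k_def abs_mult)
    ultimately have "(\<epsilon> / 2) ^ 2 + k * (1 - \<bar>\<epsilon>\<bar>) \<le> (of_int n + \<epsilon> / 2) ^ 2"
      unfolding k_def by (simp add: power2_eq_square algebra_simps)
    then have "(pi * Im \<tau>) * ((\<epsilon> / 2) ^ 2 + k * (1 - \<bar>\<epsilon>\<bar>)) \<le> (pi * Im \<tau>) * (of_int n + \<epsilon> / 2) ^ 2"
      using \<tau> by (intro mult_left_mono) auto
    then have "norm (f n) \<le> norm (f 0) * exp (k * (- pi * (Im \<tau> * (1 - \<bar>\<epsilon>\<bar>))))"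
      by (simp add: f_def norm_theta_term algebra_simps flip: exp_add)
    also have "exp (k * (- pi * (Im \<tau> * (1 - \<bar>\<epsilon>\<bar>)))) = r ^ nat \<bar>n\<bar>"
      by (simp add: r_def k_def flip: exp_of_nat_mult)
    finally show ?thesis .
  qed
  have "((\<lambda>n. norm (f 0) * r ^ nat \<bar>n\<bar>) has_sum norm (f 0) * (2 * (r / (1 - r)))) (- {0})"
    by (intro has_sum_cmult_right has_sum_power_nonzero_int) (use r in linarith)+
  then have le: "norm (- f 0) \<le> norm (f 0) * (2 * (r / (1 - r)))"
    by (rule norm_infsum_le[OF tail]) (rule term_le)
  have "norm (f 0) > 0"
    by (simp add: f_def norm_theta_term)
  moreover have "2 * (r / (1 - r)) < 1"
    using r by (simp add: field_simps)
  ultimately have "norm (f 0) * (2 * (r / (1 - r))) < norm (f 0) * 1"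
    by (intro mult_strict_left_mono)
  with le show False
    by simp
qed

text \<open>
  By the duplication formula, if no \<open>\<theta>[\<epsilon>,\<epsilon>']\<close> with first characteristic \<open>\<epsilon>\<close> or \<open>0\<close> vanishes at \<open>2 \<tau>\<close>,
  then none vanishes at \<open>\<tau>\<close>. The bound for large imaginary part is independent of the second
  characteristic, which changes from step to step, so it starts the induction on the number of
  doublings.
\<close>

lemma theta_const_neq_0:
  assumes "\<bar>\<epsilon>\<bar> < 1" and "Im \<tau> > 0"
  shows "theta_const \<epsilon> \<epsilon>' \<tau> \<noteq> 0"
proof -
  have descent: "theta_const \<epsilon> \<epsilon>' \<tau> \<noteq> 0"
    if "\<bar>\<epsilon>\<bar> < 1" "Im \<tau> > 0" "2 ^ k * (Im \<tau> * (1 - \<bar>\<epsilon>\<bar>)) \<ge> 1" for k \<epsilon> \<epsilon>' \<tau>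
    using that
  proof (induction k arbitrary: \<epsilon> \<epsilon>' \<tau>)
    case 0
    then show ?case
      by (intro theta_const_neq_0_large_Im) auto
  next
    case (Suc k)
    have Im2: "Im (2 * \<tau>) > 0"
      using Suc.prems by simp
    have "2 ^ k * (Im (2 * \<tau>) * (1 - \<bar>\<epsilon>\<bar>)) = 2 ^ Suc k * (Im \<tau> * (1 - \<bar>\<epsilon>\<bar>))"
      by simp
    with Suc.prems have growth: "2 ^ k * (Im (2 * \<tau>) * (1 - \<bar>\<epsilon>\<bar>)) \<ge> 1"
      by (simp only:)
    have "2 ^ k * (Im (2 * \<tau>) * (1 - \<bar>\<epsilon>\<bar>)) \<le> 2 ^ k * (Im (2 * \<tau>) * (1 - \<bar>0\<bar>))"
      using Im2 by (intro mult_left_mono) auto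
    with growth have growth_0: "2 ^ k * (Im (2 * \<tau>) * (1 - \<bar>0\<bar>)) \<ge> 1"
      by (rule order_trans)
    have "theta_const \<epsilon> (2 * \<epsilon>' + 1) (2 * \<tau>) \<noteq> 0"
      by (rule Suc.IH[OF Suc.prems(1) Im2 growth])
    moreover have "theta_const 0 1 (2 * \<tau>) \<noteq> 0"
      by (rule Suc.IH[OF _ Im2 growth_0]) simp
    ultimately show ?case
      using theta_const_duplication[OF Suc.prems(2), of \<epsilon> \<epsilon>'] by auto
  qed
  obtain k :: nat where "1 / (Im \<tau> * (1 - \<bar>\<epsilon>\<bar>)) < 2 ^ k"
    using real_arch_pow[of 2] by auto
  then have "2 ^ k * (Im \<tau> * (1 - \<bar>\<epsilon>\<bar>)) \<ge> 1"
    using assms by (simp add: divide_less_eq)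
  then show ?thesis
    by (rule descent[OF assms])
qed

section \<open>Bilinear identities between the moduli \<open>\<tau>\<close> and \<open>2 \<tau>\<close>\<close>

lemma theta_const_0_0_square:
  assumes "Im \<tau> > 0"
  shows "theta_const 0 0 \<tau> ^ 2 = theta_const 0 0 (2 * \<tau>) ^ 2 + theta_const 1 0 (2 * \<tau>) ^ 2"
proof -
  have \<tau>2: "Im (2 * \<tau>) > 0"
    using assms by simp
  define F where "F m n = theta_term \<tau> (of_real (0 / 2)) (of_int m + 0 / 2)
      * theta_term \<tau> (of_real (0 / 2)) (of_int n + 0 / 2)" for m n :: int
  have F: "((\<lambda>(m, n). F m n) has_sum theta_const 0 0 \<tau> * theta_const 0 0 \<tau>) UNIV"
    unfolding F_def by (rule has_sum_theta_const_mult[OF assms])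
  have even: "F (p + q) (p - q) = theta_term (2 * \<tau>) (of_real (0 / 2)) (of_int p + 0 / 2)
      * theta_term (2 * \<tau>) (of_real (0 / 2)) (of_int q + 0 / 2)" for p q
    unfolding F_def using theta_term_mult[of \<tau> 0 "of_int p" "of_int q" 0] by simp
  have odd: "F (- p - q - 1) (q - p) = theta_term (2 * \<tau>) (of_real (0 / 2)) (of_int p + 1 / 2)
      * theta_term (2 * \<tau>) (of_real (0 / 2)) (of_int q + 1 / 2)" for p q
  proof -
    have "F (- p - q - 1) (q - p) =
        theta_term \<tau> 0 (- (of_int p + 1 / 2) + - (of_int q + 1 / 2))
        * theta_term \<tau> 0 (- (of_int p + 1 / 2) - - (of_int q + 1 / 2))"
      by (simp add: F_def algebra_simps)
    then show ?thesis
      unfolding theta_term_mult theta_term_minus by simp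
  qed
  have "((\<lambda>(m, n). F m n) has_sum theta_const 0 0 (2 * \<tau>) * theta_const 0 0 (2 * \<tau>)
      + theta_const 1 0 (2 * \<tau>) * theta_const 1 0 (2 * \<tau>)) UNIV"
    by (intro has_sum_parity_split; unfold even odd; rule has_sum_theta_const_mult[OF \<tau>2])
  then show ?thesis
    using has_sum_unique[OF F] by (simp add: power2_eq_square)
qed

text \<open>
  Reflecting \<open>x = p + 1/4\<close> multiplies the term by \<open>exp (- 4 \<pi> \<i> \<epsilon>' x)\<close>. Because \<open>2 \<epsilon>'\<close> is an integer,
  this factor does not depend on \<open>p\<close>, so it can be pulled out of the sum over the odd pairs.
\<close>

lemma theta_term_quarter_reflect:
  assumes "\<epsilon>' = of_int r + 1 / 2"
  shows "theta_term \<tau> (of_real \<epsilon>') (- (of_int p + 1 / 4)) =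
           e2pi (- of_real \<epsilon>' / 2) * theta_term \<tau> (of_real \<epsilon>') (of_int p + 1 / 4)"
proof -
  have "theta_term \<tau> (of_real \<epsilon>') (- (of_int p + 1 / 4)) =
      theta_term \<tau> (of_real \<epsilon>' + (- 2 * of_real \<epsilon>')) (of_int p + 1 / 4)"
    unfolding theta_term_minus by simp
  also have "\<dots> = e2pi (of_real (of_int p + 1 / 4) * (- 2 * of_real \<epsilon>'))
      * theta_term \<tau> (of_real \<epsilon>') (of_int p + 1 / 4)"
    by (rule theta_term_add)
  also have "e2pi (of_real (of_int p + 1 / 4) * (- 2 * of_real \<epsilon>')) = e2pi (- of_real \<epsilon>' / 2)"
    by (rule e2pi_eqI[of _ _ "- (2 * r * p + p)"]) (simp add: assms algebra_simps)
  finally show ?thesis .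
qed

lemma theta_term_quarter_mult_even:
  "theta_term \<tau> (of_real (\<epsilon>' / 2)) (of_int (p + q) + 1 / 4)
     * theta_term \<tau> (of_real (\<epsilon>' / 2)) (of_int (p - q) + 1 / 4) =
   theta_term (2 * \<tau>) (of_real \<epsilon>') (of_int p + 1 / 4) * theta_term (2 * \<tau>) 0 (of_int q)"
proof -
  have "theta_term \<tau> (of_real (\<epsilon>' / 2)) (of_int (p + q) + 1 / 4)
      * theta_term \<tau> (of_real (\<epsilon>' / 2)) (of_int (p - q) + 1 / 4) =
    theta_term \<tau> (of_real (\<epsilon>' / 2)) ((of_int p + 1 / 4) + of_int q)
      * theta_term \<tau> (of_real (\<epsilon>' / 2)) ((of_int p + 1 / 4) - of_int q)"
    by (intro arg_cong2[where f = "(*)"] arg_cong[where f = "theta_term \<tau> (of_real (\<epsilon>' / 2))"]) auto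
  then show ?thesis
    unfolding theta_term_mult by simp
qed

lemma theta_term_quarter_mult_odd:
  assumes "\<epsilon>' = of_int r + 1 / 2"
  shows "theta_term \<tau> (of_real (\<epsilon>' / 2)) (of_int (- p - q - 1) + 1 / 4)
     * theta_term \<tau> (of_real (\<epsilon>' / 2)) (of_int (q - p) + 1 / 4) =
   e2pi (- of_real \<epsilon>' / 2)
     * (theta_term (2 * \<tau>) (of_real \<epsilon>') (of_int p + 1 / 4) * theta_term (2 * \<tau>) 0 (of_int q + 1 / 2))"
proof -
  have "theta_term \<tau> (of_real (\<epsilon>' / 2)) (of_int (- p - q - 1) + 1 / 4)
      * theta_term \<tau> (of_real (\<epsilon>' / 2)) (of_int (q - p) + 1 / 4) =
    theta_term \<tau> (of_real (\<epsilon>' / 2)) (- (of_int p + 1 / 4) + - (of_int q + 1 / 2))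
      * theta_term \<tau> (of_real (\<epsilon>' / 2)) (- (of_int p + 1 / 4) - - (of_int q + 1 / 2))"
    by (intro arg_cong2[where f = "(*)"] arg_cong[where f = "theta_term \<tau> (of_real (\<epsilon>' / 2))"]) auto
  also have "\<dots> = theta_term (2 * \<tau>) (of_real \<epsilon>') (- (of_int p + 1 / 4))
      * theta_term (2 * \<tau>) 0 (of_int q + 1 / 2)"
    unfolding theta_term_mult theta_term_minus[of _ _ "of_int q + 1 / 2"] by simp
  finally show ?thesis
    unfolding theta_term_quarter_reflect[OF assms] by simp
qed

text \<open>
  For \<open>x = m + 1/4\<close> and \<open>y = n + 1/4\<close> the half-sum is \<open>\<plusminus> (p + 1/4)\<close>, while the half-difference runs
  through the integers for the even pairs and through the half-integers for the odd ones.
\<close>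

lemma theta_const_quarter_square:
  assumes "Im \<tau> > 0" and \<epsilon>': "\<epsilon>' = of_int r + 1 / 2"
  shows "theta_const (1/2) \<epsilon>' \<tau> ^ 2 = theta_const (1/2) (2 * \<epsilon>') (2 * \<tau>)
      * (theta_const 0 0 (2 * \<tau>) + e2pi (- of_real \<epsilon>' / 2) * theta_const 1 0 (2 * \<tau>))"
proof -
  have \<tau>2: "Im (2 * \<tau>) > 0"
    using assms by simp
  define F where "F m n = theta_term \<tau> (of_real (\<epsilon>' / 2)) (of_int m + 1 / 4)
      * theta_term \<tau> (of_real (\<epsilon>' / 2)) (of_int n + 1 / 4)" for m n :: int
  have F: "((\<lambda>(m, n). F m n) has_sum theta_const (1/2) \<epsilon>' \<tau> * theta_const (1/2) \<epsilon>' \<tau>) UNIV"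
    using has_sum_theta_const_mult[OF assms(1), of \<epsilon>' "1/2" \<epsilon>' "1/2"] by (simp add: F_def)
  have "((\<lambda>(p, q). F (p + q) (p - q)) has_sum
      theta_const (1/2) (2 * \<epsilon>') (2 * \<tau>) * theta_const 0 0 (2 * \<tau>)) UNIV"
    unfolding F_def theta_term_quarter_mult_even
    using has_sum_theta_const_mult[OF \<tau>2, of "2 * \<epsilon>'" "1/2" 0 0] by simp
  moreover have "((\<lambda>(p, q). F (- p - q - 1) (q - p)) has_sum e2pi (- of_real \<epsilon>' / 2)
      * (theta_const (1/2) (2 * \<epsilon>') (2 * \<tau>) * theta_const 1 0 (2 * \<tau>))) UNIV"
    unfolding F_def theta_term_quarter_mult_odd[OF \<epsilon>'] case_prod_unfold
    using has_sum_theta_const_mult[OF \<tau>2, of "2 * \<epsilon>'" "1/2" 0 1]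
    by (intro has_sum_cmult_right) (simp add: case_prod_unfold)
  ultimately have "((\<lambda>(m, n). F m n) has_sum
      theta_const (1/2) (2 * \<epsilon>') (2 * \<tau>) * theta_const 0 0 (2 * \<tau>)
      + e2pi (- of_real \<epsilon>' / 2)
        * (theta_const (1/2) (2 * \<epsilon>') (2 * \<tau>) * theta_const 1 0 (2 * \<tau>))) UNIV"
    by (rule has_sum_parity_split)
  then show ?thesis
    using has_sum_unique[OF F] by (simp add: power2_eq_square algebra_simps)
qed

text \<open>
  The same rearrangement as for the square, applied to the symmetrised weight \<open>x + y\<close> in place of
  \<open>x\<close>: this weight is twice the half-sum, hence it changes sign under the reflection, and the odd
  pairs contribute with the sign opposite to that in the square.
\<close>

lemma theta_deriv_const_mult_theta_const_quarter:
  assumes "Im \<tau> > 0" and \<epsilon>': "\<epsilon>' = of_int r + 1 / 2"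
  shows "theta_deriv_const (1/2) \<epsilon>' \<tau> * theta_const (1/2) \<epsilon>' \<tau> =
      theta_deriv_const (1/2) (2 * \<epsilon>') (2 * \<tau>)
      * (theta_const 0 0 (2 * \<tau>) - e2pi (- of_real \<epsilon>' / 2) * theta_const 1 0 (2 * \<tau>))"
proof -
  have \<tau>2: "Im (2 * \<tau>) > 0"
    using assms by simp
  define t where "t m = theta_term \<tau> (of_real (\<epsilon>' / 2)) (of_int m + 1 / 4)" for m :: int
  define F where "F m n = of_real (of_int m + of_int n + 1 / 2) * (t m * t n)" for m n :: int
  define D where "D = theta_deriv_const (1/2) \<epsilon>' \<tau> / (2 * of_real pi * \<i>)"
  define D2 where "D2 = theta_deriv_const (1/2) (2 * \<epsilon>') (2 * \<tau>) / (2 * of_real pi * \<i>)"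
  have "((\<lambda>(m, n). of_real (of_int m + 1 / 4) * t m * t n + t m * (of_real (of_int n + 1 / 4) * t n))
      has_sum D * theta_const (1/2) \<epsilon>' \<tau> + theta_const (1/2) \<epsilon>' \<tau> * D) UNIV"
    using has_sum_add[OF has_sum_theta_deriv_const_mult[OF assms(1), of "1/2" \<epsilon>' \<epsilon>' "1/2"]
        has_sum_theta_const_mult_deriv[OF assms(1), of \<epsilon>' "1/2" "1/2" \<epsilon>']]
    by (simp add: t_def D_def case_prod_unfold)
  also have "(\<lambda>(m, n). of_real (of_int m + 1 / 4) * t m * t n + t m * (of_real (of_int n + 1 / 4) * t n)) =
      (\<lambda>(m, n). F m n)"
    by (auto simp: F_def fun_eq_iff algebra_simps)
  finally have F: "((\<lambda>(m, n). F m n) has_sum D * theta_const (1/2) \<epsilon>' \<tau> + theta_const (1/2) \<epsilon>' \<tau> * D) UNIV" .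
  have even: "F (p + q) (p - q) = 2 * (of_real (of_int p + 1 / 4)
      * theta_term (2 * \<tau>) (of_real \<epsilon>') (of_int p + 1 / 4) * theta_term (2 * \<tau>) 0 (of_int q))" for p q
    unfolding F_def t_def theta_term_quarter_mult_even by (simp add: algebra_simps)
  have odd: "F (- p - q - 1) (q - p) = (- 2 * e2pi (- of_real \<epsilon>' / 2)) * (of_real (of_int p + 1 / 4)
      * theta_term (2 * \<tau>) (of_real \<epsilon>') (of_int p + 1 / 4) * theta_term (2 * \<tau>) 0 (of_int q + 1 / 2))" for p q
    unfolding F_def t_def theta_term_quarter_mult_odd[OF \<epsilon>'] by (simp add: algebra_simps)
  have "((\<lambda>(p, q). F (p + q) (p - q)) has_sum 2 * (D2 * theta_const 0 0 (2 * \<tau>))) UNIV"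
    unfolding even case_prod_unfold
    using has_sum_theta_deriv_const_mult[OF \<tau>2, of "1/2" "2 * \<epsilon>'" 0 0]
    by (intro has_sum_cmult_right) (simp add: case_prod_unfold D2_def)
  moreover have "((\<lambda>(p, q). F (- p - q - 1) (q - p)) has_sum
      (- 2 * e2pi (- of_real \<epsilon>' / 2)) * (D2 * theta_const 1 0 (2 * \<tau>))) UNIV"
    unfolding odd case_prod_unfold
    using has_sum_theta_deriv_const_mult[OF \<tau>2, of "1/2" "2 * \<epsilon>'" 0 1]
    by (intro has_sum_cmult_right) (simp add: case_prod_unfold D2_def)
  ultimately have "((\<lambda>(m, n). F m n) has_sum 2 * (D2 * theta_const 0 0 (2 * \<tau>))
      + (- 2 * e2pi (- of_real \<epsilon>' / 2)) * (D2 * theta_const 1 0 (2 * \<tau>))) UNIV"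
    by (rule has_sum_parity_split)
  from has_sum_unique[OF F this]
  have "2 * (D * theta_const (1/2) \<epsilon>' \<tau>) =
      2 * (D2 * (theta_const 0 0 (2 * \<tau>) - e2pi (- of_real \<epsilon>' / 2) * theta_const 1 0 (2 * \<tau>)))"
    by (simp add: algebra_simps)
  then have "D * theta_const (1/2) \<epsilon>' \<tau> =
      D2 * (theta_const 0 0 (2 * \<tau>) - e2pi (- of_real \<epsilon>' / 2) * theta_const 1 0 (2 * \<tau>))"
    by simp
  then show ?thesis
    by (simp add: D_def D2_def field_simps)
qed

text \<open>
  For \<open>x = m + 1/2\<close> and \<open>y = n\<close> the even pairs have half-sum \<open>p + 1/4\<close> and half-difference
  \<open>q + 1/4\<close>, so the weight \<open>x\<close> is the sum of these two and yields \<open>D T + T D\<close>. The odd pairs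
  correspond to \<open>(- x, - y)\<close>; the sign of the weight cancels against the sign of
  \<open>exp (\<pi> \<i> x)\<close>, so they contribute the same amount. On each product of two terms, passing from the
  characteristic \<open>1/2\<close> to \<open>r + 1/2\<close> costs the constant factor \<open>exp (\<pi> \<i> r) = (-1)^r\<close>.
\<close>

lemma theta_deriv_const_1_1_mult_theta_const_0_0:
  assumes "Im \<tau> > 0" and \<epsilon>': "\<epsilon>' = of_int r + 1 / 2"
  shows "e2pi (of_int r / 2) * (theta_deriv_const 1 1 \<tau> * theta_const 0 0 \<tau>) =
      4 * (theta_deriv_const (1/2) (2 * \<epsilon>') (2 * \<tau>) * theta_const (1/2) (2 * \<epsilon>') (2 * \<tau>))"
proof -
  have \<tau>2: "Im (2 * \<tau>) > 0"
    using assms by simp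
  define t where "t p = theta_term (2 * \<tau>) (of_real \<epsilon>') (of_int p + 1 / 4)" for p :: int
  define h where "h p = theta_term (2 * \<tau>) (1 / 2) (of_int p + 1 / 4)" for p :: int
  define F where "F m n = e2pi (of_int r / 2) * (of_real (of_int m + 1 / 2)
      * theta_term \<tau> (1 / 2) (of_int m + 1 / 2) * theta_term \<tau> 0 (of_int n))" for m n :: int
  define D where "D = theta_deriv_const 1 1 \<tau> / (2 * of_real pi * \<i>)"
  define D2 where "D2 = theta_deriv_const (1/2) (2 * \<epsilon>') (2 * \<tau>) / (2 * of_real pi * \<i>)"
  define T2 where "T2 = theta_const (1/2) (2 * \<epsilon>') (2 * \<tau>)"
  have F: "((\<lambda>(m, n). F m n) has_sum e2pi (of_int r / 2) * (D * theta_const 0 0 \<tau>)) UNIV"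
    using has_sum_cmult_right[OF has_sum_theta_deriv_const_mult[OF assms(1), of 1 1 0 0], of "e2pi (of_int r / 2)"]
    by (simp add: F_def D_def case_prod_unfold)
  have th: "e2pi (of_int r / 2) * (h p * h q) = t p * t q" for p q
  proof -
    have t: "t p = e2pi (of_real (of_int p + 1 / 4) * of_int r) * h p" for p
      unfolding t_def h_def theta_term_add[symmetric] by (simp add: \<epsilon>' add.commute)
    have "t p * t q = e2pi (of_real (of_int p + 1 / 4) * of_int r + of_real (of_int q + 1 / 4) * of_int r)
        * (h p * h q)"
      unfolding t e2pi_add by simp
    also have "e2pi (of_real (of_int p + 1 / 4) * of_int r + of_real (of_int q + 1 / 4) * of_int r) =
        e2pi (of_int r / 2)"
      by (rule e2pi_eqI[of _ _ "(p + q) * r"]) (simp add: algebra_simps)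
    finally show ?thesis
      by simp
  qed
  have even: "F (p + q) (p - q) =
      of_real (of_int p + 1 / 4) * t p * t q + t p * (of_real (of_int q + 1 / 4) * t q)" for p q
  proof -
    have "theta_term \<tau> (1 / 2) (of_int (p + q) + 1 / 2) * theta_term \<tau> 0 (of_int (p - q)) =
        theta_term \<tau> (1 / 2) ((of_int p + 1 / 4) + (of_int q + 1 / 4))
        * theta_term \<tau> 0 ((of_int p + 1 / 4) - (of_int q + 1 / 4))"
      by (simp add: algebra_simps)
    also have "\<dots> = h p * h q"
      unfolding theta_term_mult h_def by simp
    finally have "F (p + q) (p - q) =
        of_real (of_int (p + q) + 1 / 2) * (e2pi (of_int r / 2) * (h p * h q))"
      by (simp add: F_def mult_ac)
    then show ?thesis
      unfolding th by (simp add: algebra_simps)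
  qed
  have odd: "F (- p - q - 1) (q - p) = F (p + q) (p - q)" for p q
  proof -
    have "theta_term \<tau> (1 / 2) (of_int (- p - q - 1) + 1 / 2) =
        theta_term \<tau> (1 / 2) (- (of_int (p + q) + 1 / 2))"
      by (rule arg_cong[where f = "theta_term \<tau> (1 / 2)"]) simp
    also have "\<dots> = theta_term \<tau> (1 / 2 + (- 1)) (of_int (p + q) + 1 / 2)"
      unfolding theta_term_minus by simp
    also have "\<dots> = e2pi (- (of_int (p + q) + 1 / 2)) * theta_term \<tau> (1 / 2) (of_int (p + q) + 1 / 2)"
      unfolding theta_term_add by simp
    also have "e2pi (- (of_int (p + q) + 1 / 2)) = - e2pi (of_int 0)"
      by (rule e2pi_uminus_eqI[of _ _ "- (p + q) - 1"]) simp
    finally have t1: "theta_term \<tau> (1 / 2) (of_int (- p - q - 1) + 1 / 2) =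
        - theta_term \<tau> (1 / 2) (of_int (p + q) + 1 / 2)"
      unfolding e2pi_of_int by simp
    have t2: "theta_term \<tau> 0 (of_int (q - p)) = theta_term \<tau> 0 (of_int (p - q))"
      using theta_term_minus[of \<tau> 0 "of_int (p - q)"] by simp
    have t3: "of_real (of_int (- p - q - 1) + 1 / 2) = - complex_of_real (of_int (p + q) + 1 / 2)"
      by (simp add: algebra_simps)
    show ?thesis
      unfolding F_def t1 t2 t3 by (simp only: minus_mult_minus)
  qed
  have half: "((\<lambda>(p, q). F (p + q) (p - q)) has_sum D2 * T2 + T2 * D2) UNIV"
    unfolding even
    using has_sum_add[OF has_sum_theta_deriv_const_mult[OF \<tau>2, of "1/2" "2 * \<epsilon>'" "2 * \<epsilon>'" "1/2"]
        has_sum_theta_const_mult_deriv[OF \<tau>2, of "2 * \<epsilon>'" "1/2" "1/2" "2 * \<epsilon>'"]]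
    by (simp add: t_def D2_def T2_def case_prod_unfold)
  have half_odd: "((\<lambda>(p, q). F (- p - q - 1) (q - p)) has_sum D2 * T2 + T2 * D2) UNIV"
    unfolding odd by (rule half)
  have "((\<lambda>(m, n). F m n) has_sum (D2 * T2 + T2 * D2) + (D2 * T2 + T2 * D2)) UNIV"
    using half half_odd by (rule has_sum_parity_split)
  then have "e2pi (of_int r / 2) * (D * theta_const 0 0 \<tau>) = 4 * (D2 * T2)"
    using has_sum_unique[OF F] by simp
  then show ?thesis
    by (simp add: D_def D2_def T2_def field_simps)
qed

lemma theta_deriv_const_quarter:
  assumes "Im \<tau> > 0" and \<epsilon>': "\<epsilon>' = of_int r + 1 / 2"
  shows "theta_deriv_const (1/2) \<epsilon>' \<tau> =
      e2pi (of_int r / 2) / 4 * (theta_deriv_const 1 1 \<tau> * theta_const 0 0 \<tau> ^ 3 / theta_const (1/2) \<epsilon>' \<tau> ^ 3)"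
proof -
  define \<iota> where "\<iota> = e2pi (- of_real \<epsilon>' / 2)"
  define A where "A = theta_const 0 0 (2 * \<tau>)"
  define B where "B = theta_const 1 0 (2 * \<tau>)"
  define T2 where "T2 = theta_const (1/2) (2 * \<epsilon>') (2 * \<tau>)"
  define D2 where "D2 = theta_deriv_const (1/2) (2 * \<epsilon>') (2 * \<tau>)"
  define T where "T = theta_const (1/2) \<epsilon>' \<tau>"
  define D where "D = theta_deriv_const (1/2) \<epsilon>' \<tau>"
  have "\<iota> * \<iota> = e2pi (- of_real \<epsilon>')"
    by (simp add: \<iota>_def flip: e2pi_add)
  also have "\<dots> = - e2pi (of_int 0)"
    by (rule e2pi_uminus_eqI[of _ _ "- r - 1"]) (simp add: \<epsilon>')
  finally have \<iota>: "\<iota> * \<iota> = - 1"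
    unfolding e2pi_of_int .
  have "T \<noteq> 0"
    unfolding T_def using assms(1) by (intro theta_const_neq_0) auto
  have "D * T ^ 3 = (D * T) * T ^ 2"
    by (simp add: power2_eq_square power3_eq_cube)
  also have "\<dots> = (D2 * (A - \<iota> * B)) * (T2 * (A + \<iota> * B))"
    using theta_deriv_const_mult_theta_const_quarter[OF assms] theta_const_quarter_square[OF assms]
    by (simp add: D_def T_def D2_def T2_def A_def B_def \<iota>_def)
  also have "\<dots> = (D2 * T2) * (A ^ 2 - (\<iota> * \<iota>) * B ^ 2)"
    by (simp add: algebra_simps power2_eq_square)
  also have "\<dots> = (D2 * T2) * theta_const 0 0 \<tau> ^ 2"
    by (simp add: \<iota> theta_const_0_0_square[OF assms(1)] A_def B_def)
  also have "D2 * T2 = e2pi (of_int r / 2) / 4 * (theta_deriv_const 1 1 \<tau> * theta_const 0 0 \<tau>)"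
    using theta_deriv_const_1_1_mult_theta_const_0_0[OF assms] by (simp add: D2_def T2_def)
  finally have "D * T ^ 3 = e2pi (of_int r / 2) / 4 * (theta_deriv_const 1 1 \<tau> * theta_const 0 0 \<tau> ^ 3)"
    by (simp add: power2_eq_square power3_eq_cube)
  then show ?thesis
    using \<open>T \<noteq> 0\<close> by (simp add: D_def T_def field_simps)
qed

text \<open>
  The two characteristics are the cases \<open>r = 0\<close> and \<open>r = 1\<close>, and \<open>e2pi (r / 2)\<close> is \<open>1\<close> and
  \<open>- 1\<close>, respectively.
\<close>

theorem theorem3p3:
  fixes \<tau> :: complex
  assumes "Im \<tau> > 0"
  shows "theta_deriv_const (1/2) (1/2) \<tau> =
           1 / 4 * (theta_deriv_const 1 1 \<tau> * theta_const 0 0 \<tau> ^ 3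
             / theta_const (1/2) (1/2) \<tau> ^ 3)
       \<and> theta_deriv_const (1/2) (3/2) \<tau> =
           - (1 / 4) * (theta_deriv_const 1 1 \<tau> * theta_const 0 0 \<tau> ^ 3
             / theta_const (1/2) (3/2) \<tau> ^ 3)"
  using theta_deriv_const_quarter[OF assms, of "1/2" 0] theta_deriv_const_quarter[OF assms, of "3/2" 1]
    e2pi_of_int[of 0]
  by (simp add: e2pi_half)

end
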